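(* Let $V_3$ be a $3$-dimensional subspace of $\mathbb{F}_3^4$ and $H=\{A_\lambda:\lambda\in V_3\}\cong(Z_3)^3$. The three $27$-sets $\mathcal{R}_H,\mathcal{R}'_H,\mathcal{R}''_H$ are all Segre varieties $\mathcal{S}_3(2)$ if and only if the projective plane $\mathbb{P}V_3\subset\operatorname{PG}(3,3)$ is of kind $\mathcal{P}_0$, i.e. contains none of the four points $\langle1000\rangle,\langle0100\rangle,\langle0010\rangle,\langle0001\rangle$. Consequently the $81$-set $\omega_4$ contains precisely $24$ copies of a Segre variety $\mathcal{S}_3(2)$.
   Context: Work over $\mathbb{F}_2$. $V_8=V(8,2)$ with basis $e_1,\dots,e_8$, $V_a=\langle e_1,e_8\rangle$, $V_b=\langle e_2,e_7\rangle$, $V_c=\langle e_3,e_6\rangle$, $V_d=\langle e_4,e_5\rangle$; points of $\operatorname{PG}(7,2)$ are nonzero vectors; $\omega_4$ is the set of vectors all four of whose components in $V_a,\dots,V_d$ are nonzero. Let $\zeta_a: e_1\mapsto e_8\mapsto e_1+e_8\mapsto e_1$, $\zeta_b: e_7\mapsto e_2\mapsto e_2+e_7\mapsto e_7$, $\zeta_c: e_3\mapsto e_6\mapsto e_3+e_6\mapsto e_3$, $\zeta_d: e_5\mapsto e_4\mapsto e_4+e_5\mapsto e_5$. For $\lambda=ijkl\in\mathbb{F}_3^4$ let $A_\lambda=\zeta_a^i\oplus\zeta_b^j\oplus\zeta_c^k\oplus\zeta_d^l$; $\lambda\mapsto A_\lambda$ is an isomorphism of $(\mathbb{F}_3^4,+)$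 onto a group $\mathcal{G}_{81}\cong(Z_3)^4$. Let $u=e_1+\dots+e_8$; then $\omega_4=\{A_\lambda u:\lambda\in\mathbb{F}_3^4\}$ bijectively. For a subgroup $H\cong(Z_3)^3$ of $\mathcal{G}_{81}$ with cosets $H,H',H''$, set $\mathcal{R}_H=\{hu:h\in H\}$, $\mathcal{R}'_H=\{hu:h\in H'\}$, $\mathcal{R}''_H=\{hu:h\in H''\}$, a partition of $\omega_4$ into three $27$-sets. A Segre variety $\mathcal{S}_3(2)$ in $\operatorname{PG}(7,2)$ is the image, under some linear isomorphism $V(2,2)\otimes V(2,2)\otimes V(2,2)\to V_8$, of the set of nonzero pure tensors $\{x\otimes y\otimes z\}$ ($27$ points). *)

theory Defs
  imports
    "HOL-Analysis.Analysis"
    "HOL-Algebra.Coset"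
    "HOL-Library.Z2"
    "Berlekamp_Zassenhaus.Finite_Field"
begin

section \<open>The fields with two and three elements\<close>

text \<open>
  The field with two elements is the library type \<^typ>\<open>bit\<close>. The field with three elements is
  \<open>'a mod_ring\<close> for an index type \<open>'a\<close> with three elements; the elements of the index type
  play no role of their own.
\<close>

datatype three = Three0 | Three1 | Three2

lemma UNIV_three: "(UNIV :: three set) = {Three0, Three1, Three2}"
  using three.exhaust by auto

lemma CARD_three: "CARD(three) = 3"
  by (simp add: UNIV_three)

instance three :: finite
  by standard (simp add: UNIV_three)

instance three :: prime_card
  by standard (simp add: CARD_three)

type_synonym gf3 = "three mod_ring"

type_synonym V8 = "bit ^ 8"


section \<open>The space \<open>V(8,2)\<close> and the set \<open>\<omega>\<^sub>4\<close>\<close>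

text \<open>In the index type \<open>8\<close> the numeral \<open>8\<close> equals \<open>0\<close>, so \<open>1, \<dots>, 8\<close> are its eight
  distinct elements; likewise \<open>1, \<dots>, 4\<close> for the index type \<open>4\<close>.\<close>

definition e_vec :: "8 \<Rightarrow> V8" where
  "e_vec i = axis i 1"

lemma e_vec_component: "e_vec i $ j = (if j = i then 1 else 0)"
  by (simp add: e_vec_def axis_def)

definition V_a :: "V8 set" where "V_a = vec.span {e_vec 1, e_vec 8}"
definition V_b :: "V8 set" where "V_b = vec.span {e_vec 2, e_vec 7}"
definition V_c :: "V8 set" where "V_c = vec.span {e_vec 3, e_vec 6}"
definition V_d :: "V8 set" where "V_d = vec.span {e_vec 4, e_vec 5}"

definition omega4 :: "V8 set" where
  "omega4 = {a + b + c + d | a b c d.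
     a \<in> V_a - {0} \<and> b \<in> V_b - {0} \<and> c \<in> V_c - {0} \<and> d \<in> V_d - {0}}"

definition u_vec :: V8 where
  "u_vec = (\<Sum>i\<in>UNIV. e_vec i)"


section \<open>The group \<open>\<G>\<^sub>8\<^sub>1\<close>\<close>

text \<open>For \<open>p \<noteq> q\<close>, the linear map with
  \<open>e_vec p \<mapsto> e_vec q \<mapsto> e_vec p + e_vec q \<mapsto> e_vec p\<close> that fixes all other basis vectors.\<close>

definition zeta :: "8 \<Rightarrow> 8 \<Rightarrow> V8 \<Rightarrow> V8" where
  "zeta p q v = v $ p *s e_vec q + v $ q *s (e_vec p + e_vec q) + (\<Sum>i\<in>- {p, q}. v $ i *s e_vec i)"

lemma linear_zeta: "Vector_Spaces.linear (*s) (*s) (zeta p q)"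
proof unfold_locales
  show "zeta p q (v + w) = zeta p q v + zeta p q w" for v w
    by (simp only: zeta_def vector_add_component vec.scale_left_distrib sum.distrib ac_simps)
  show "zeta p q (r *s v) = r *s zeta p q v" for r v
    by (simp only: zeta_def vector_smult_component vec.scale_right_distrib vec.scale_scale
        vec.scale_sum_right)
qed

lemma zeta_basis:
  assumes "p \<noteq> q"
  shows "zeta p q (e_vec p) = e_vec q"
    and "zeta p q (e_vec q) = e_vec p + e_vec q"
    and "zeta p q (e_vec p + e_vec q) = e_vec p"
    and "i \<notin> {p, q} \<Longrightarrow> zeta p q (e_vec i) = e_vec i"
proof -
  interpret Vector_Spaces.linear "(*s)" "(*s)" "zeta p q"
    by (rule linear_zeta)
  have out: "(\<Sum>i\<in>- {p, q}. (e_vec j $ i) *s e_vec i) = 0" if "j \<in> {p, q}" for j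
    using that by (intro sum.neutral) (auto simp: e_vec_def axis_def)
  show p: "zeta p q (e_vec p) = e_vec q"
    using assms out[of p] by (simp add: zeta_def) (simp add: e_vec_def axis_def)
  show q: "zeta p q (e_vec q) = e_vec p + e_vec q"
    using assms out[of q] by (simp add: zeta_def) (simp add: e_vec_def axis_def)
  have "e_vec q + e_vec q = 0"
    by (simp add: vec_eq_iff)
  then show "zeta p q (e_vec p + e_vec q) = e_vec p"
    by (simp add: add p q)
  assume i: "i \<notin> {p, q}"
  have "(\<Sum>j\<in>- {p, q}. (e_vec i $ j) *s e_vec j) = (\<Sum>j\<in>- {p, q}. if j = i then e_vec i else 0)"
    by (intro sum.cong) (auto simp: e_vec_def axis_def)
  also have "\<dots> = e_vec i"
    using i by (subst sum.delta) auto
  finally show "zeta p q (e_vec i) = e_vec i"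
    using i by (auto simp: zeta_def e_vec_component)
qed

definition zeta_a :: "V8 \<Rightarrow> V8" where "zeta_a = zeta 1 8"
definition zeta_b :: "V8 \<Rightarrow> V8" where "zeta_b = zeta 7 2"
definition zeta_c :: "V8 \<Rightarrow> V8" where "zeta_c = zeta 3 6"
definition zeta_d :: "V8 \<Rightarrow> V8" where "zeta_d = zeta 5 4"

definition gf3_nat :: "gf3 \<Rightarrow> nat" where
  "gf3_nat x = nat (to_int_mod_ring x)"

text \<open>Each of the four factors acts on one summand of \<open>V_a \<oplus> V_b \<oplus> V_c \<oplus> V_d\<close> and as the
  identity on the others, so that their composition is the direct sum of the four powers.\<close>

definition A_map :: "gf3 ^ 4 \<Rightarrow> V8 \<Rightarrow> V8" where
  "A_map l = (zeta_a ^^ gf3_nat (l $ 1)) \<circ> (zeta_b ^^ gf3_nat (l $ 2)) \<circ>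
         (zeta_c ^^ gf3_nat (l $ 3)) \<circ> (zeta_d ^^ gf3_nat (l $ 4))"

definition G81 :: "(V8 \<Rightarrow> V8) monoid" where
  "G81 = \<lparr>carrier = range A_map, mult = (\<circ>), one = id\<rparr>"

text \<open>For \<open>K\<close> running through the three cosets of \<open>H\<close> in \<^const>\<open>G81\<close>, these are the sets
  \<open>\<R>\<^sub>H\<close>, \<open>\<R>'\<^sub>H\<close>, \<open>\<R>''\<^sub>H\<close>.\<close>

definition R_set :: "(V8 \<Rightarrow> V8) set \<Rightarrow> V8 set" where
  "R_set K = {h u_vec | h. h \<in> K}"


section \<open>Segre varieties\<close>

text \<open>The tensor product of three copies of \<open>V(2,2)\<close> is the space of \<open>2 \<times> 2 \<times> 2\<close> arrays.\<close>

definition pure_tensor :: "bit ^ 2 \<Rightarrow> bit ^ 2 \<Rightarrow> bit ^ 2 \<Rightarrow> bit ^ (2 \<times> 2 \<times> 2)" where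
  "pure_tensor x y z = vec_lambda (\<lambda>(i, j, k). x $ i * y $ j * z $ k)"

definition is_segre_variety :: "V8 set \<Rightarrow> bool" where
  "is_segre_variety S \<longleftrightarrow>
     (\<exists>f. Vector_Spaces.linear (*s) (*s) f \<and> bij f \<and>
          S = f ` ({pure_tensor x y z | x y z. True} - {0}))"


section \<open>Planes of \<open>PG(3,3)\<close>\<close>

text \<open>The projective space of a subspace, as its set of points.\<close>

definition proj_points :: "(gf3 ^ 4) set \<Rightarrow> (gf3 ^ 4) set set" where
  "proj_points W = {P. vec.subspace P \<and> vec.dim P = 1 \<and> P \<subseteq> W}"

definition kind_P0 :: "(gf3 ^ 4) set set \<Rightarrow> bool" where
  "kind_P0 X \<longleftrightarrow> (\<forall>i. vec.span {axis i 1} \<notin> X)"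

end

theory Submission
  imports Defs
begin

text \<open>
  Label \<open>\<omega>\<^sub>4\<close> by \<open>l \<mapsto> A_map l u_vec\<close>. If \<open>f\<close> is a linear isomorphism mapping the nonzero pure tensors into
  \<open>\<omega>\<^sub>4\<close>, then each coordinate of the label of \<open>f (x \<otimes> y \<otimes> z)\<close> is a function of three points of the
  projective line over \<open>GF(2)\<close>, i.e.\ of three elements of \<open>GF(3)\<close>. Three nonzero vectors of \<open>V(2,2)\<close>
  have sum zero iff they are distinct, so this function is a Latin cube of order 3, hence affine with
  nonzero coefficients \<open>a\<^sub>m, b\<^sub>m, g\<^sub>m\<close>. Surjectivity of \<open>f\<close> makes the four coefficient triples pairwise
  non-proportional; then the \<open>4 \<times> 4\<close> matrix with rows \<open>a, b, g, abg\<close> is orthogonal over \<open>GF(3)\<close>, and the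
  labels form the affine hyperplane \<open>n \<bullet> l = c\<close> with \<open>n = abg\<close>, which has no zero coordinate. Conversely,
  every such hyperplane arises in this way. There are \<open>8 \<cdot> 3 = 24\<close> of them, and the cosets of \<open>H\<close>
  are the hyperplanes parallel to \<open>V3\<close>.
\<close>

text \<open>These rules turn the field operations into bit operations, out of reach of the ring lemmas.\<close>

declare add_bit_eq_xor [simp del] mult_bit_eq_and [simp del]

section \<open>Arithmetic in GF(2) and GF(3), and labels for the nonzero vectors of V(2,2)\<close>

lemma UNIV_bit: "(UNIV :: bit set) = {0, 1}"
  using bit_not_zero_iff by blast

instance bit :: finite
  by standard (simp add: UNIV_bit)

lemma bit_add_self [simp]: "(x::bit) + x = 0"
  by (cases x rule: bit.exhaust) auto

lemma bit_add_eqI: "x + y + z = 0 \<Longrightarrow> x + y = (z :: bit)"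
  and bit_add_eqI': "x + y + z = 0 \<Longrightarrow> y + z = (x :: bit)"
  by (cases x rule: bit.exhaust; cases y rule: bit.exhaust; cases z rule: bit.exhaust; simp)+

lemma exhaust_8:
  fixes x :: 8
  shows "x = 1 \<or> x = 2 \<or> x = 3 \<or> x = 4 \<or> x = 5 \<or> x = 6 \<or> x = 7 \<or> x = 8"
proof (induct x)
  case (of_int z)
  then have "0 \<le> z" and "z < 8" by simp_all
  then have "z = 0 \<or> z = 1 \<or> z = 2 \<or> z = 3 \<or> z = 4 \<or> z = 5 \<or> z = 6 \<or> z = 7" by arith
  then show ?case by auto
qed

lemma gf3_cases: "x = 0 \<or> x = 1 \<or> x = (- 1 :: gf3)"
  by transfer (auto simp: CARD_three)

lemma gf3_one_add_one [simp]: "1 + 1 = (- 1 :: gf3)"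
  by transfer (auto simp: CARD_three)

lemma gf3_two [simp]: "2 = (- 1 :: gf3)"
  by (simp flip: one_add_one)

lemma gf3_minus_one_sub_one [simp]: "- 1 - 1 = (1 :: gf3)"
  by transfer (auto simp: CARD_three)

lemma gf3_one_neq_minus_one [simp]: "(1 :: gf3) \<noteq> - 1" "- 1 \<noteq> (1 :: gf3)"
  by (transfer; auto simp: CARD_three)+

lemma gf3_nz_cases: "x \<noteq> 0 \<longleftrightarrow> x = 1 \<or> x = (- 1 :: gf3)"
  using gf3_cases[of x] by auto

lemma gf3_mult_cancel: "x \<noteq> 0 \<Longrightarrow> x * (x * y) = (y :: gf3)"
  using gf3_cases[of x] by auto

lemma UNIV_gf3: "(UNIV :: gf3 set) = {0, 1, - 1}"
  using gf3_cases by auto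

text \<open>Turns the iteration counts in \<open>A_map\<close> back into elements of GF(3).\<close>

lemma of_nat_gf3_nat: "of_nat (gf3_nat x) = x"
proof -
  have "x = of_int_mod_ring (to_int_mod_ring x)"
    by simp
  moreover have "to_int_mod_ring x \<ge> 0"
    by transfer simp
  ultimately show ?thesis
    by (simp add: gf3_nat_def of_nat_of_int_mod_ring)
qed

text \<open>The coordinates of \<open>\<zeta> ^ s (e_vec p + e_vec q)\<close>, where \<open>\<zeta> = zeta p q\<close>, at \<open>p\<close> (\<open>True\<close>) and \<open>q\<close> (\<open>False\<close>).\<close>

definition pair_coord :: "bool \<Rightarrow> gf3 \<Rightarrow> bit" where
  "pair_coord b s = (if s = (if b then - 1 else 1) then 0 else 1)"

text \<open>The labels s, s + d, s - d exhaust GF(3), and the three nonzero vectors of V(2,2) sum to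
  zero.\<close>

lemma pair_coord_sum: "pair_coord b s + pair_coord b (s + d) + pair_coord b (s - d) = 0" if "d \<noteq> 0"
  using gf3_cases[of s] gf3_cases[of d] that
  by (cases b) (auto simp: pair_coord_def)

lemma pair_coord_add: "pair_coord b s + pair_coord b (s + d) = pair_coord b (s - d)" if "d \<noteq> 0"
  by (rule bit_add_eqI) (rule pair_coord_sum[OF that])

text \<open>Two equal labels would cancel over GF(2), leaving the third vector zero; but no label
  encodes the zero vector.\<close>

lemma pair_coord_sum_eq_0D:
  assumes "\<And>b. pair_coord b r + pair_coord b s + pair_coord b t = 0"
  shows "r \<noteq> s" "r \<noteq> t" "s \<noteq> t"
  using assms[of True] assms[of False] gf3_cases[of r] gf3_cases[of s] gf3_cases[of t]
  by (auto simp: pair_coord_def)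

lemma pair_coord_inj:
  assumes "\<And>b. pair_coord b s = pair_coord b t"
  shows "s = t"
  using assms[of True] assms[of False] gf3_cases[of s] gf3_cases[of t]
  by (auto simp: pair_coord_def)

lemma pair_coord_surj: "\<exists>s. pair_coord True s = x \<and> pair_coord False s = y" if "x \<noteq> 0 \<or> y \<noteq> 0"
proof -
  have "(x, y) = (1, 1) \<or> (x, y) = (1, 0) \<or> (x, y) = (0, 1)"
    using that by (cases x rule: bit.exhaust; cases y rule: bit.exhaust) auto
  then show ?thesis
    by (auto simp: pair_coord_def intro: exI[of _ 0] exI[of _ 1] exI[of _ "- 1"])
qed

lemma pair_coord_nonzero: "\<exists>b. pair_coord b s \<noteq> 0"
proof (rule exI)
  \<comment> \<open>The coordinate at p vanishes only for s = -1, and there the one at q is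
    1.\<close>
  show "pair_coord (s \<noteq> - 1) s \<noteq> 0"
    by (simp add: pair_coord_def)
qed

text \<open>Every permutation of the three nonzero vectors of \<open>V(2,2)\<close> is linear.\<close>

lemma pair_coord_linear:
  assumes "r \<noteq> 0"
  shows "\<exists>x y. \<forall>s. pair_coord True (r * s + d) = x * pair_coord True s + y * pair_coord False s"
proof (intro exI allI)
  \<comment> \<open>The labels 1 and -1 encode the two basis vectors, so \<open>?x\<close> and
    \<open>?y\<close> are the first coordinates of their images.\<close>
  let ?x = "pair_coord True (r + d)" and ?y = "pair_coord True (- r + d)"
  show "pair_coord True (r * s + d) = ?x * pair_coord True s + ?y * pair_coord False s" for s
    using assms gf3_cases[of r] gf3_cases[of d] gf3_cases[of s]
    by (elim disjE) (auto simp: pair_coord_def)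
qed

text \<open>\<open>pos m\<close> lists the two basis indices of the \<open>m\<close>-th summand in the order in which the
  corresponding \<open>\<zeta>\<close> takes them.\<close>

definition pos :: "4 \<Rightarrow> bool \<Rightarrow> 8" where
  "pos m b =
    (if m = 1 then if b then 1 else 8
     else if m = 2 then if b then 7 else 2
     else if m = 3 then if b then 3 else 6
     else if b then 5 else 4)"

definition blk :: "8 \<Rightarrow> 4" where
  "blk j = (if j \<in> {1, 8} then 1 else if j \<in> {2, 7} then 2 else if j \<in> {3, 6} then 3 else 4)"

text \<open>In each of the four summands the index that comes first in the order of
  \<open>pos\<close> is the odd one.\<close>

definition side :: "8 \<Rightarrow> bool" where
  "side j \<longleftrightarrow> j \<in> {1, 3, 5, 7}"

lemma pos_blk_side [simp]: "pos (blk j) (side j) = j"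
  using exhaust_8[of j] by (elim disjE; simp add: pos_def blk_def side_def)

lemma blk_pos [simp]: "blk (pos m b) = m"
  using exhaust_4[of m] by (elim disjE; cases b; simp add: pos_def blk_def)

lemma side_pos [simp]: "side (pos m b) = b"
  using exhaust_4[of m] by (elim disjE; cases b; simp add: pos_def side_def)

lemma pos_eq_iff [simp]: "pos m b = pos m' b' \<longleftrightarrow> m = m' \<and> b = b'"
proof
  assume "pos m b = pos m' b'"
  then have "blk (pos m b) = blk (pos m' b')" "side (pos m b) = side (pos m' b')"
    by simp_all
  then show "m = m' \<and> b = b'"
    unfolding blk_pos side_pos by simp
qed simp

section \<open>The labelling of \<open>omega4\<close> by GF(3)^4\<close>

lemma V8_eqI:
  assumes "\<And>m b. v $ pos m b = w $ pos m b"
  shows "v = (w :: V8)"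
  unfolding vec_eq_iff
proof
  show "v $ j = w $ j" for j
    using assms[of "blk j" "side j"] by simp
qed

text \<open>This is \<open>A_map l u_vec\<close> in coordinates, as \<open>A_map_enc\<close> and
  \<open>u_vec_eq\<close> show; the group then acts on labels by translation.\<close>

definition enc :: "gf3 ^ 4 \<Rightarrow> V8" where
  "enc l = (\<chi> j. pair_coord (side j) (l $ blk j))"

lemma enc_pos [simp]: "enc l $ pos m b = pair_coord b (l $ m)"
  by (simp add: enc_def)

lemma inj_enc: "inj enc"
proof (rule injI)
  fix k l
  assume "enc k = enc l"
  then have "pair_coord b (k $ m) = pair_coord b (l $ m)" for m b
    by (simp flip: enc_pos)
  then show "k = l"
    by (simp add: vec_eq_iff pair_coord_inj)
qed

lemma u_vec_eq: "u_vec = enc 0"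
  by (simp add: vec_eq_iff u_vec_def e_vec_component enc_def pair_coord_def)

lemma zeta_component:
  assumes "p \<noteq> q"
  shows "zeta p q v $ j = (if j = p then v $ q else if j = q then v $ p + v $ q else v $ j)"
proof -
  have "(\<Sum>i\<in>- {p, q}. (v $ i *s e_vec i) $ j) = (\<Sum>i\<in>- {p, q}. if i = j then v $ j else 0)"
    by (intro sum.cong) (auto simp: e_vec_component)
  also have "\<dots> = (if j \<in> {p, q} then 0 else v $ j)"
    by (subst sum.delta) auto
  finally show ?thesis
    using assms by (auto simp: zeta_def e_vec_component)
qed

text \<open>The labels 0, 1, -1 stand for e_p + e_q, e_p, e_q, the order in which
  \<open>zeta p q\<close> cycles through them.\<close>

lemma zeta_enc: "zeta (pos m True) (pos m False) (enc l) = enc (l + axis m 1)"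
proof (rule V8_eqI)
  fix m' b
  show "zeta (pos m True) (pos m False) (enc l) $ pos m' b = enc (l + axis m 1) $ pos m' b"
    using gf3_cases[of "l $ m"]
    by (cases b) (auto simp: zeta_component axis_def pair_coord_def)
qed

lemma zeta_power_enc:
  "(zeta (pos m True) (pos m False) ^^ k) (enc l) = enc (l + axis m (of_nat k))"
proof (induction k)
  case (Suc k)
  have "axis m (of_nat k) + axis m 1 = (axis m (of_nat (Suc k)) :: gf3 ^ 4)"
    by (auto simp: vec_eq_iff axis_def)
  with Suc show ?case
    by (simp add: zeta_enc add.assoc)
qed (simp add: axis_eq_0_iff[THEN iffD2])

lemma A_map_enc: "A_map l (enc k) = enc (l + k)"
proof -
  have z: "zeta_a = zeta (pos 1 True) (pos 1 False)" "zeta_b = zeta (pos 2 True) (pos 2 False)"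
    "zeta_c = zeta (pos 3 True) (pos 3 False)" "zeta_d = zeta (pos 4 True) (pos 4 False)"
    by (simp_all add: zeta_a_def zeta_b_def zeta_c_def zeta_d_def pos_def)
  \<comment> \<open>The increments appear in the order in which the composition applies its factors,
    the last one first.\<close>
  have "k + axis 4 (l $ 4) + axis 3 (l $ 3) + axis 2 (l $ 2) + axis 1 (l $ 1) = l + k"
    by (simp add: vec_eq_iff forall_4 axis_def)
  then show ?thesis
    by (simp only: A_map_def z zeta_power_enc of_nat_gf3_nat o_apply)
qed

lemma V_span_iff:
  assumes "p \<noteq> q"
  shows "v \<in> vec.span {e_vec p, e_vec q} \<longleftrightarrow> (\<forall>j. j \<noteq> p \<longrightarrow> j \<noteq> q \<longrightarrow> v $ j = 0)"
proof -
  have "v \<in> vec.span {e_vec p, e_vec q} \<longleftrightarrow> (\<exists>x y. v = x *s e_vec p + y *s e_vec q)"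
    unfolding vec.span_insert vec.span_singleton
    by (simp add: diff_eq_eq image_iff) (metis add.commute)
  also have "\<dots> \<longleftrightarrow> (\<forall>j. j \<noteq> p \<longrightarrow> j \<noteq> q \<longrightarrow> v $ j = 0)"
  proof safe
    assume *: "\<forall>j. j \<noteq> p \<longrightarrow> j \<noteq> q \<longrightarrow> v $ j = 0"
    then have "v = v $ p *s e_vec p + v $ q *s e_vec q"
      using assms by (auto simp: vec_eq_iff e_vec_component)
    then show "\<exists>x y. v = x *s e_vec p + y *s e_vec q" by blast
  qed (simp add: e_vec_component)
  finally show ?thesis .
qed

lemma V_span_nonzero:
  assumes "v \<in> vec.span {e_vec p, e_vec q} - {0}" "p \<noteq> q"
  shows "v $ p \<noteq> 0 \<or> v $ q \<noteq> 0"
proof (rule ccontr)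
  assume "\<not> ?thesis"
  then have "v $ j = 0" for j
    using assms by (cases "j = p \<or> j = q") (auto simp: V_span_iff)
  with assms show False by (simp add: vec_eq_iff)
qed

lemma omega4_eq: "omega4 = range enc"
proof (intro equalityI subsetI)
  fix v
  assume "v \<in> omega4"
  then obtain a b c d where v: "v = a + b + c + d"
    and mem: "a \<in> V_a - {0}" "b \<in> V_b - {0}" "c \<in> V_c - {0}" "d \<in> V_d - {0}"
    by (auto simp: omega4_def)
  have "\<exists>s. pair_coord True s = v $ pos m True \<and> pair_coord False s = v $ pos m False" for m
  \<comment> \<open>On the two coordinates of summand m only one of a, b, c, d contributes, and it
    does not vanish there.\<close>
  proof (rule pair_coord_surj)
    have "a $ 1 \<noteq> 0 \<or> a $ 8 \<noteq> 0" "b $ 2 \<noteq> 0 \<or> b $ 7 \<noteq> 0"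
      "c $ 3 \<noteq> 0 \<or> c $ 6 \<noteq> 0" "d $ 4 \<noteq> 0 \<or> d $ 5 \<noteq> 0"
      using mem unfolding V_a_def V_b_def V_c_def V_d_def
      by (intro V_span_nonzero; simp)+
    then show "v $ pos m True \<noteq> 0 \<or> v $ pos m False \<noteq> 0"
      using mem exhaust_4[of m] unfolding v V_a_def V_b_def V_c_def V_d_def
      by (elim disjE[of "m = _"]) (simp_all add: V_span_iff pos_def disj_commute)
  qed
  then obtain l where "\<And>m. pair_coord True (l m) = v $ pos m True"
    "\<And>m. pair_coord False (l m) = v $ pos m False"
    by metis
  then have "v = enc (\<chi> m. l m)"
    by (intro V8_eqI) (case_tac b; simp)
  then show "v \<in> range enc" by blast
next
  fix v
  assume "v \<in> range enc"
  then obtain l where v: "v = enc l" by blast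
  \<comment> \<open>\<open>w m\<close> is the projection of v to the m-th summand.\<close>
  define w where "w m = (\<chi> j. if blk j = m then v $ j else 0)" for m
  have "w m \<noteq> 0" for m
  proof -
    obtain b where "pair_coord b (l $ m) \<noteq> 0"
      using pair_coord_nonzero by blast
    then have "w m $ pos m b \<noteq> 0" by (simp add: w_def v)
    then show ?thesis by auto
  qed
  moreover have "v = w 1 + w 2 + w 3 + w 4"
  proof -
    have "v $ j = (w 1 + w 2 + w 3 + w 4) $ j" for j
      using exhaust_4[of "blk j"] by (elim disjE) (simp_all add: w_def)
    then show ?thesis by (simp add: vec_eq_iff)
  qed
  moreover have "w 1 \<in> V_a" "w 2 \<in> V_b" "w 3 \<in> V_c" "w 4 \<in> V_d"
    unfolding V_a_def V_b_def V_c_def V_d_def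
    by (simp_all add: V_span_iff w_def blk_def) (metis exhaust_8)
  ultimately show "v \<in> omega4"
    unfolding omega4_def by blast
qed

section \<open>Latin cubes of order three and affine hyperplanes\<close>

text \<open>All six permutations of GF(3) are affine: there are two nonzero slopes and three
  constants.\<close>

lemma inj_gf3_affine:
  assumes "inj (t :: gf3 \<Rightarrow> gf3)"
  shows "t 1 - t 0 \<noteq> 0" "t i = t 0 + (t 1 - t 0) * i"
proof -
  have ne: "t 0 \<noteq> t 1" "t 0 \<noteq> t (- 1)" "t 1 \<noteq> t (- 1)"
    using assms by (simp_all add: inj_eq)
  then show "t 1 - t 0 \<noteq> 0" by simp
  show "t i = t 0 + (t 1 - t 0) * i"
    using ne gf3_cases[of "t 0"] gf3_cases[of "t 1"] gf3_cases[of "t (- 1)"] gf3_cases[of i]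
    by (elim disjE) (simp_all only:, simp_all)
qed

text \<open>Rows are affine by \<open>inj_gf3_affine\<close>. Two rows of different slopes would
  agree at some k, against injectivity of column k.\<close>

lemma latin_square_slope:
  fixes t :: "'a \<Rightarrow> gf3 \<Rightarrow> gf3"
  assumes row: "\<And>x. inj (t x)" and col: "\<And>k. inj (\<lambda>x. t x k)"
  shows "t x 1 - t x 0 = t y 1 - t y 0"
proof (rule ccontr)
  let ?b = "\<lambda>x. t x 1 - t x 0"
  assume ne: "?b x \<noteq> ?b y"
  define k where "k = (t y 0 - t x 0) / (?b x - ?b y)"
  have "k * (?b x - ?b y) = t y 0 - t x 0"
    using ne by (simp add: k_def)
  then have "t x 0 + ?b x * k = t y 0 + ?b y * k"
    by (simp add: algebra_simps)
  then have "t x k = t y k"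
    by (simp flip: inj_gf3_affine(2)[OF row])
  then have "x = y"
    using injD[OF col] by blast
  with ne show False by simp
qed

text \<open>Fixing one index leaves a Latin square, so by \<open>latin_square_slope\<close> the
  slope in k depends on neither i nor j, and the slope in j at k = 0 does not depend on i.\<close>

lemma latin_cube_affine:
  fixes t :: "gf3 \<Rightarrow> gf3 \<Rightarrow> gf3 \<Rightarrow> gf3"
  assumes "\<And>j k. inj (\<lambda>i. t i j k)" "\<And>i k. inj (\<lambda>j. t i j k)" "\<And>i j. inj (\<lambda>k. t i j k)"
  shows "\<exists>a b g. a \<noteq> 0 \<and> b \<noteq> 0 \<and> g \<noteq> 0 \<and> (\<forall>i j k. t i j k = t 0 0 0 + i * a + j * b + k * g)"
proof (intro exI conjI allI)
  fix i j k
  let ?g = "\<lambda>i j. t i j 1 - t i j 0" and ?b = "\<lambda>i. t i 1 0 - t i 0 0"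
  have "?g i j = ?g 0 j"
    using latin_square_slope[of "\<lambda>i k. t i j k" i 0] assms by blast
  also have "\<dots> = ?g 0 0"
    using latin_square_slope[of "\<lambda>j k. t 0 j k" j 0] assms by blast
  finally have g: "?g i j = ?g 0 0" .
  have b: "?b i = ?b 0"
    using latin_square_slope[of "\<lambda>i j. t i j 0" i 0] assms by blast
  have "t i j k = t i j 0 + ?g i j * k"
    using assms inj_gf3_affine(2)[of "\<lambda>k. t i j k"] by blast
  moreover have "t i j 0 = t i 0 0 + ?b i * j"
    using assms inj_gf3_affine(2)[of "\<lambda>j. t i j 0"] by blast
  moreover have "t i 0 0 = t 0 0 0 + (t 1 0 0 - t 0 0 0) * i"
    using assms inj_gf3_affine(2)[of "\<lambda>i. t i 0 0"] by blast
  ultimately show "t i j k = t 0 0 0 + i * (t 1 0 0 - t 0 0 0) + j * ?b 0 + k * ?g 0 0"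
    unfolding g b by (simp add: mult.commute)
next
  show "t 1 0 0 - t 0 0 0 \<noteq> 0" "t 0 1 0 - t 0 0 0 \<noteq> 0" "t 0 0 1 - t 0 0 0 \<noteq> 0"
    using inj_gf3_affine(1)[of "\<lambda>i. t i 0 0"] inj_gf3_affine(1)[of "\<lambda>i. t 0 i 0"]
      inj_gf3_affine(1)[of "\<lambda>i. t 0 0 i"] assms by simp_all
qed

definition hyperplane :: "gf3 ^ 4 \<Rightarrow> gf3 \<Rightarrow> (gf3 ^ 4) set" where
  "hyperplane n c = {l. (\<Sum>m\<in>UNIV. n $ m * l $ m) = c}"

text \<open>Two signs agree and the third is opposite, so the sum is the majority sign and the
  product its negative. This gives the off-diagonal zeros of the Hadamard matrix below.\<close>

lemma sum_signs:
  assumes "x \<noteq> 0" "y \<noteq> 0" "z \<noteq> 0" "\<not> (x = y \<and> y = z)"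
  shows "x + y + z + x * y * z = (0 :: gf3)"
  using assms unfolding gf3_nz_cases by (elim disjE) simp_all

lemma gf3_square [simp]: "x \<noteq> 0 \<Longrightarrow> x * x = (1 :: gf3)"
  using gf3_cases[of x] by auto

text \<open>Over \<open>GF(3)\<close> the \<open>4 \<times> 4\<close> matrix with rows \<open>a\<close>, \<open>b\<close>, \<open>g\<close> and \<open>abg\<close> is orthogonal
  (a Hadamard matrix, and \<open>4 = 1\<close>).\<close>

lemma affine_image_eq_hyperplane:
  fixes c a b g n :: "gf3 ^ 4"
  assumes nz: "\<And>m. a $ m \<noteq> 0" "\<And>m. b $ m \<noteq> 0" "\<And>m. g $ m \<noteq> 0"
    and np: "\<And>m m' s. \<lbrakk>m \<noteq> m'; s \<noteq> 0; a $ m' = s * a $ m; b $ m' = s * b $ m; g $ m' = s * g $ m\<rbrakk>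
      \<Longrightarrow> False"
    and n: "n = (\<chi> m. a $ m * b $ m * g $ m)"
  shows "{c + i *s a + j *s b + k *s g | i j k. True} = hyperplane n (\<Sum>m\<in>UNIV. n $ m * c $ m)"
proof -
  define M :: "gf3 ^ 4 ^ 4" where
    "M = (\<chi> r. if r = 1 then a else if r = 2 then b else if r = 3 then g else n)"
  have "(transpose M ** M) $ m $ m' = mat 1 $ m $ m'" for m m'
  proof -
    have "(transpose M ** M) $ m $ m' = a $ m * a $ m' + b $ m * b $ m' + g $ m * g $ m' +
        (a $ m * a $ m') * (b $ m * b $ m') * (g $ m * g $ m')"
      by (simp add: matrix_matrix_mult_def transpose_def M_def sum_4 n ac_simps)
    also have "\<dots> = mat 1 $ m $ m'"
    proof (cases "m = m'")
      case True
      then show ?thesis by (simp add: nz mat_def)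
    next
      case False
      \<comment> \<open>Otherwise columns m and m' of the coefficients would be proportional, with
        factor \<open>a $ m * a $ m'\<close>.\<close>
      have "\<not> (a $ m * a $ m' = b $ m * b $ m' \<and> b $ m * b $ m' = g $ m * g $ m')"
      proof
        assume eq: "a $ m * a $ m' = b $ m * b $ m' \<and> b $ m * b $ m' = g $ m * g $ m'"
        have sq: "x * y * x = y" if "x \<noteq> 0" for x y :: gf3
          using that gf3_square[of x] by (metis mult.assoc mult.commute mult_1)
        show False
          using np[OF False, of "a $ m * a $ m'"] eq nz sq by (metis mult_eq_0_iff)
      qed
      then show ?thesis
        using False by (simp add: sum_signs nz mat_def)
    qed
    finally show ?thesis .
  qed
  then have MM: "transpose M ** M = mat 1"
    by (simp add: vec_eq_iff)
  then have MM': "M ** transpose M = mat 1"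
    using matrix_left_right_inverse by blast
  \<comment> \<open>By orthogonality \<open>M *v w\<close> lists the coordinates of w in the basis
    a, b, g, n. The fourth one is the scalar product with n, whose vanishing puts w in the span of
    a, b, g.\<close>
  have comb: "transpose M *v w = w $ 1 *s a + w $ 2 *s b + w $ 3 *s g + w $ 4 *s n" for w
    by (simp add: vec_eq_iff matrix_vector_mult_def transpose_def M_def sum_4 mult.commute)
  have fourth: "(M *v w) $ 4 = (\<Sum>m\<in>UNIV. n $ m * w $ m)" for w
    by (simp add: matrix_vector_mult_def M_def)
  have in_hyp: "l \<in> hyperplane n (\<Sum>m\<in>UNIV. n $ m * c $ m) \<longleftrightarrow> (M *v (l - c)) $ 4 = 0" for l
    by (simp add: hyperplane_def fourth right_diff_distrib sum_subtractf)
  show ?thesis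
  proof (intro equalityI subsetI)
    fix l
    assume "l \<in> {c + i *s a + j *s b + k *s g | i j k. True}"
    then obtain i j k where l: "l = c + i *s a + j *s b + k *s g" by blast
    define w :: "gf3 ^ 4" where
      "w = (\<chi> r. if r = 1 then i else if r = 2 then j else if r = 3 then k else 0)"
    have "l - c = transpose M *v w"
      unfolding comb by (simp add: l w_def)
    then have "M *v (l - c) = w"
      by (simp only: matrix_vector_mul_assoc MM' matrix_vector_mul_lid)
    then show "l \<in> hyperplane n (\<Sum>m\<in>UNIV. n $ m * c $ m)"
      by (simp add: in_hyp w_def)
  next
    fix l
    assume "l \<in> hyperplane n (\<Sum>m\<in>UNIV. n $ m * c $ m)"
    then have "(M *v (l - c)) $ 4 = 0" by (simp add: in_hyp)
    moreover have "l - c = transpose M *v (M *v (l - c))"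
      by (simp only: matrix_vector_mul_assoc MM matrix_vector_mul_lid)
    ultimately have "l - c = (M *v (l - c)) $ 1 *s a + (M *v (l - c)) $ 2 *s b + (M *v (l - c)) $ 3 *s g"
      unfolding comb by simp
    then have "l = c + (M *v (l - c)) $ 1 *s a + (M *v (l - c)) $ 2 *s b + (M *v (l - c)) $ 3 *s g"
      by (simp add: diff_eq_eq add.commute add.left_commute)
    then show "l \<in> {c + i *s a + j *s b + k *s g | i j k. True}"
      by blast
  qed
qed

section \<open>Segre varieties inside \<open>\<omega>\<^sub>4\<close>\<close>

lemma enc_sum: "enc l + enc (l + d) + enc (l - d) = 0" if "\<And>m. d $ m \<noteq> 0"
  by (rule V8_eqI) (simp add: pair_coord_sum that)

text \<open>Points of a line inside \<open>omega4\<close> have distinct labels in every coordinate,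
  which is the source of the Latin property.\<close>

lemma enc_sum_eq_0D:
  assumes "enc k + enc l + enc r = 0"
  shows "k $ m \<noteq> l $ m"
proof -
  have "pair_coord b (k $ m) + pair_coord b (l $ m) + pair_coord b (r $ m) = 0" for b
    using arg_cong[OF assms, of "\<lambda>v. v $ pos m b"] by simp
  then show ?thesis by (rule pair_coord_sum_eq_0D)
qed

section \<open>Parametrisation of the Segre variety by GF(3)^3\<close>

definition line_point :: "gf3 \<Rightarrow> bit ^ 2" where
  "line_point i = (\<chi> r. pair_coord (r = 1) i)"

lemma line_point_sum: "line_point i + line_point (i + d) + line_point (i - d) = 0" if "d \<noteq> 0"
  by (simp add: vec_eq_iff line_point_def pair_coord_sum that)

lemma line_point_nonzero: "line_point i \<noteq> 0"
proof -
  obtain b where b: "pair_coord b i \<noteq> 0"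
    using pair_coord_nonzero by blast
  have "line_point i $ (if b then 1 else 2) \<noteq> 0"
    using b by (cases b) (simp_all add: line_point_def)
  then show ?thesis by auto
qed

lemma line_point_surj: "\<exists>i. x = line_point i" if "x \<noteq> 0"
proof -
  have "x $ 1 \<noteq> 0 \<or> x $ 2 \<noteq> 0"
    using that by (simp add: vec_eq_iff forall_2)
  then obtain i where "pair_coord True i = x $ 1" "pair_coord False i = x $ 2"
    using pair_coord_surj by blast
  then have "x = line_point i"
    by (simp add: vec_eq_iff forall_2 line_point_def)
  then show ?thesis ..
qed

lemma pure_tensor_add:
  "pure_tensor (x + x') y z = pure_tensor x y z + pure_tensor x' y z"
  "pure_tensor x (y + y') z = pure_tensor x y z + pure_tensor x y' z"
  "pure_tensor x y (z + z') = pure_tensor x y z + pure_tensor x y z'"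
  by (auto simp: vec_eq_iff pure_tensor_def algebra_simps)

lemma pure_tensor_zero [simp]:
  "pure_tensor 0 y z = 0" "pure_tensor x 0 z = 0" "pure_tensor x y 0 = 0"
  by (auto simp: vec_eq_iff pure_tensor_def)

lemma pure_tensor_axis: "pure_tensor (axis r 1) (axis s 1) (axis t 1) = axis (r, s, t) 1"
  by (auto simp: vec_eq_iff pure_tensor_def axis_def)

lemma pure_tensor_eq_0_iff: "pure_tensor x y z = 0 \<longleftrightarrow> x = 0 \<or> y = 0 \<or> z = 0"
proof
  assume *: "pure_tensor x y z = 0"
  show "x = 0 \<or> y = 0 \<or> z = 0"
  proof (rule ccontr)
    assume "\<not> ?thesis"
    then obtain r s t where "x $ r \<noteq> 0" "y $ s \<noteq> 0" "z $ t \<noteq> 0"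
      by (auto simp: vec_eq_iff)
    then have "pure_tensor x y z $ (r, s, t) \<noteq> 0"
      by (simp add: pure_tensor_def)
    with * show False by simp
  qed
qed auto

definition segre_point :: "gf3 \<Rightarrow> gf3 \<Rightarrow> gf3 \<Rightarrow> bit ^ (2 \<times> 2 \<times> 2)" where
  "segre_point i j k = pure_tensor (line_point i) (line_point j) (line_point k)"

lemma nonzero_pure_tensors_eq:
  "{pure_tensor x y z | x y z. True} - {0} = {segre_point i j k | i j k. True}"
proof (intro equalityI subsetI)
  fix w
  assume "w \<in> {pure_tensor x y z | x y z. True} - {0}"
  then obtain x y z where w: "w = pure_tensor x y z" and "w \<noteq> 0"
    by blast
  then have "x \<noteq> 0" "y \<noteq> 0" "z \<noteq> 0"
    by auto
  then obtain i j k where "x = line_point i" "y = line_point j" "z = line_point k"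
    using line_point_surj by meson
  with w show "w \<in> {segre_point i j k | i j k. True}"
    by (auto simp: segre_point_def)
next
  fix w
  assume "w \<in> {segre_point i j k | i j k. True}"
  then show "w \<in> {pure_tensor x y z | x y z. True} - {0}"
    by (auto simp: segre_point_def pure_tensor_eq_0_iff line_point_nonzero)
qed

text \<open>Varying one tensor factor over the three points of the projective line gives a line of
  the variety.\<close>

lemma segre_point_sum:
  assumes "d \<noteq> 0"
  shows "segre_point i j k + segre_point (i + d) j k + segre_point (i - d) j k = 0"
    and "segre_point i j k + segre_point i (j + d) k + segre_point i (j - d) k = 0"
    and "segre_point i j k + segre_point i j (k + d) + segre_point i j (k - d) = 0"
  by (simp_all add: segre_point_def line_point_sum assms flip: pure_tensor_add)

text \<open>The pure tensors of basis vectors already form the standard basis.\<close>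

lemma segre_points_span: "vec.span {segre_point i j k | i j k. True} = UNIV"
proof -
  have "axis q 1 \<in> {segre_point i j k | i j k. True}" for q
  proof -
    obtain r s t where q: "q = (r, s, t)"
      by (metis prod_cases3)
    have "axis q (1 :: bit) \<noteq> 0"
      by (simp add: axis_eq_0_iff)
    moreover have "axis q (1 :: bit) \<in> {pure_tensor x y z | x y z. True}"
      unfolding q pure_tensor_axis[symmetric] by blast
    ultimately have "axis q (1 :: bit) \<in> {pure_tensor x y z | x y z. True} - {0}"
      by blast
    then show ?thesis
      by (simp only: nonzero_pure_tensors_eq)
  qed
  then have "w \<in> vec.span {segre_point i j k | i j k. True}" for w
    by (subst basis_expansion[symmetric]) (intro vec.span_sum vec.span_scale vec.span_base)
  then show ?thesis by blast
qed

lemma segre_in_omega4_imp_hyperplane: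
  assumes "is_segre_variety S" and sub: "S \<subseteq> omega4"
  shows "\<exists>n c. (\<forall>m. n $ m \<noteq> 0) \<and> S = enc ` hyperplane n c"
proof -
  obtain f where f: "Vector_Spaces.linear (*s) (*s) f" "bij f"
    and S': "S = f ` ({pure_tensor x y z | x y z. True} - {0})"
    using assms unfolding is_segre_variety_def by blast
  interpret f: Vector_Spaces.linear "(*s)" "(*s)" f by (rule f(1))
  have S: "S = {f (segre_point i j k) | i j k. True}"
    unfolding S' nonzero_pure_tensors_eq by auto
  have "\<exists>l. f (segre_point i j k) = enc l" for i j k
    using sub unfolding omega4_eq S by blast
  then obtain t where t: "\<And>i j k. f (segre_point i j k) = enc (t i j k)"
    by metis
  have inj: "inj h" if "\<And>i d. d \<noteq> 0 \<Longrightarrow> h i \<noteq> h (i + d)" for h :: "gf3 \<Rightarrow> gf3"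
  proof (rule injI, rule ccontr)
    fix x y assume "h x = h y" "x \<noteq> y"
    with that[of "y - x" x] show False by simp
  qed
  have sum3: "k $ m \<noteq> l $ m" if "u + v + w = 0" "f u = enc k" "f v = enc l" "f w = enc r"
    for u v w k l r m
    using enc_sum_eq_0D[of k l r] that by (metis f.add f.zero)
  have "\<exists>a b g. a \<noteq> 0 \<and> b \<noteq> 0 \<and> g \<noteq> 0 \<and>
      (\<forall>i j k. t i j k $ m = t 0 0 0 $ m + i * a + j * b + k * g)" for m
    \<comment> \<open>Lines of the variety go to lines inside \<open>omega4\<close>, so each label
      coordinate is injective in i, j and k separately.\<close>
    by (rule latin_cube_affine; rule inj; rule sum3[OF _ t t t]; erule segre_point_sum)
  then obtain a b g where nz: "\<And>m. a m \<noteq> 0" "\<And>m. b m \<noteq> 0" "\<And>m. g m \<noteq> 0"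
    and abg: "\<And>m i j k. t i j k $ m = t 0 0 0 $ m + i * a m + j * b m + k * g m"
    by metis
  define c where "c = t 0 0 0"
  have t_eq: "t i j k = c + i *s vec_lambda a + j *s vec_lambda b + k *s vec_lambda g" for i j k
    using abg[of i j k] by (simp add: vec_eq_iff c_def)
  have np: False if m: "m \<noteq> m'" and s: "s \<noteq> 0" "a m' = s * a m" "b m' = s * b m" "g m' = s * g m"
    for m m' s
  proof -
    \<comment> \<open>With proportional slopes the label at m' is a fixed permutation of the label
      at m, and such a permutation is linear on V(2,2).\<close>
    have lin: "t i j k $ m' = s * t i j k $ m + (c $ m' - s * c $ m)" for i j k
      by (simp add: t_eq s algebra_simps)
    obtain x y where xy: "\<And>r. pair_coord True (s * r + (c $ m' - s * c $ m)) =
        x * pair_coord True r + y * pair_coord False r"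
      using pair_coord_linear[OF s(1)] by blast
    \<comment> \<open>The resulting linear relation holds on the spanning set of Segre points, hence
      on the whole image of f. The basis vector at \<open>pos m' True\<close> violates it.\<close>
    define W where "W = {w. f w $ pos m' True = x * f w $ pos m True + y * f w $ pos m False}"
    have "vec.subspace W"
      by (rule vec.subspaceI) (simp_all add: W_def f.zero f.add f.scale algebra_simps)
    moreover have "{segre_point i j k | i j k. True} \<subseteq> W"
      by (auto simp: W_def t lin xy)
    ultimately have "W = UNIV"
      using vec.span_minimal segre_points_span by blast
    moreover obtain w where "f w = e_vec (pos m' True)"
      using f(2) by (metis bij_pointE)
    ultimately show False
      using m by (auto simp: W_def e_vec_component dest!: eqset_imp_iff[of _ _ w])
  qed
  define n :: "gf3 ^ 4" where
    "n = (\<chi> m. vec_lambda a $ m * vec_lambda b $ m * vec_lambda g $ m)"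
  have "{c + i *s vec_lambda a + j *s vec_lambda b + k *s vec_lambda g | i j k. True} =
      hyperplane n (\<Sum>m\<in>UNIV. n $ m * c $ m)"
    by (rule affine_image_eq_hyperplane) (use nz np n_def in auto)
  moreover have "S = enc ` {c + i *s vec_lambda a + j *s vec_lambda b + k *s vec_lambda g | i j k. True}"
    by (auto simp: S t t_eq)
  moreover have "\<forall>m. n $ m \<noteq> 0"
    by (simp add: n_def nz)
  ultimately show ?thesis by blast
qed

lemma sum_axis [simp]: "(\<Sum>m\<in>UNIV. n $ m * axis i x $ m) = n $ i * (x :: 'a :: comm_ring_1)"
proof -
  have "(\<Sum>m\<in>UNIV. n $ m * axis i x $ m) = (\<Sum>m\<in>UNIV. if m = i then n $ i * x else 0)"
    by (intro sum.cong) (auto simp: axis_def)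
  then show ?thesis by simp
qed

text \<open>A third coordinate k absorbs the equation, since n_k is nonzero and its own
  inverse.\<close>

lemma hyperplane_two_coords:
  assumes "\<And>m. n $ m \<noteq> 0" "i \<noteq> m"
  shows "\<exists>l\<in>hyperplane n c. l $ i = x \<and> l $ m = y"
proof -
  obtain k where k: "k \<noteq> i" "k \<noteq> m"
  proof -
    have "\<not> UNIV \<subseteq> {i, m}"
      using card_mono[of "{i, m}" "UNIV :: 4 set"] card_insert_le_m1[of 2 "{m}" i] by auto
    with that show ?thesis by blast
  qed
  define l where "l = axis i x + axis m y + axis k (n $ k * (c - n $ i * x - n $ m * y))"
  have "l \<in> hyperplane n c"
    by (simp add: hyperplane_def l_def distrib_left sum.distrib gf3_mult_cancel assms(1))
  moreover have "l $ i = x" "l $ m = y"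
    using assms(2) k by (simp_all add: l_def axis_def)
  ultimately show ?thesis by blast
qed

section \<open>Hyperplanes yield Segre varieties\<close>

text \<open>\<open>l\<close> and \<open>l + axis i 1 + axis m r\<close> (with \<open>r = - n $ i * n $ m\<close>) lie on the same hyperplane, and
  the sum of their encodings vanishes outside the summands \<open>i\<close> and \<open>m\<close>. A second such pair
  cancels the component in summand \<open>i\<close>.\<close>

lemma hyperplane_span:
  assumes n: "\<And>m. n $ m \<noteq> 0"
  shows "vec.span (enc ` hyperplane n c) = UNIV"
proof -
  let ?U = "vec.span (enc ` hyperplane n c)"
  have pos: "e_vec (pos m \<beta>) \<in> ?U" for m \<beta>
  proof -
    \<comment> \<open>The label whose vector in summand m is the basis vector at
      \<open>pos m \<beta>\<close>.\<close>
    define s :: gf3 where "s = (if \<beta> then 1 else - 1)"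
    obtain i where i: "i \<noteq> m"
      using exhaust_4 that[of "m + 1"] by auto
    define r where "r = - n $ i * n $ m"
    have r: "r \<noteq> 0" by (simp add: r_def n)
    define nxt where "nxt l = l + axis i 1 + axis m r" for l
    have nxt: "nxt l \<in> hyperplane n c" if "l \<in> hyperplane n c" for l
    proof -
      have "n $ m * r = - n $ i"
        using n[of m] by (simp add: r_def mult.left_commute)
      with that show ?thesis
        by (simp add: hyperplane_def nxt_def distrib_left sum.distrib)
    qed
    \<comment> \<open>In summand m the pair k, \<open>nxt k\<close> sums to the vector labelled s +
      1, and the second pair will give s - 1; together they give s. In summand i both pairs have
      labels 0 and 1, so everything cancels.\<close>
    obtain k where k: "k \<in> hyperplane n c" "k $ i = 0" "k $ m = s + 1 + r"
      using hyperplane_two_coords[OF n i] by blast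
    obtain l where l: "l \<in> hyperplane n c" "l $ i = 0" "l $ m = s - 1 + r"
      using hyperplane_two_coords[OF n i] by blast
    have "e_vec (pos m \<beta>) = (enc k + enc (nxt k)) + (enc l + enc (nxt l))"
    proof (rule V8_eqI)
      fix m' b
      consider "m' = m" | "m' = i" | "m' \<noteq> m" "m' \<noteq> i" by blast
      then show "e_vec (pos m \<beta>) $ pos m' b = ((enc k + enc (nxt k)) + (enc l + enc (nxt l))) $ pos m' b"
      proof cases
        case 1
        have "pair_coord b (s + 1) + pair_coord b (s - 1) = pair_coord b s"
          by (rule bit_add_eqI', rule pair_coord_sum) simp
        moreover have "pair_coord b s = (if b = \<beta> then 1 else 0)"
          by (simp add: pair_coord_def s_def)
        moreover have "pair_coord b (s + 1 + r) + pair_coord b (s + 1 + r + r) = pair_coord b (s + 1)"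
          "pair_coord b (s - 1 + r) + pair_coord b (s - 1 + r + r) = pair_coord b (s - 1)"
          using pair_coord_add[OF r, of b "s + 1 + r"] pair_coord_add[OF r, of b "s - 1 + r"]
          by simp_all
        ultimately show ?thesis
          using 1 i k(3) l(3) by (auto simp: nxt_def axis_def e_vec_component)
      next
        case 2
        then show ?thesis
          using i k(2) l(2) by (simp add: nxt_def axis_def e_vec_component)
      next
        case 3
        then show ?thesis
          by (simp add: nxt_def axis_def e_vec_component)
      qed
    qed
    also have "\<dots> \<in> ?U"
      by (intro vec.span_add vec.span_base imageI nxt k(1) l(1))
    finally show ?thesis .
  qed
  have e: "e_vec j \<in> ?U" for j
    using pos[of "blk j" "side j"] by simp
  have "(\<Sum>j\<in>UNIV. v $ j *s e_vec j) \<in> ?U" for v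
    by (intro vec.span_sum vec.span_scale e)
  then have "v \<in> ?U" for v
    by (simp add: e_vec_def basis_expansion)
  then show ?thesis by blast
qed

text \<open>The labels 1 and -1 are the basis vectors of V(2,2) and 0 is their sum; the hypothesis
  says that G respects this sum.\<close>

lemma line_interpolation:
  assumes "G 0 + G 1 + G (- 1) = (0 :: V8)"
  shows "(\<Sum>r\<in>UNIV. line_point i $ r *s G (if r = (1 :: 2) then 1 else - 1)) = G i"
proof -
  have "v + v = 0" for v :: V8
    by (simp add: vec_eq_iff)
  then have "G 1 + G (- 1) = G 0"
    using assms by (simp add: vec_eq_iff) (metis add.commute bit_add_eqI add.assoc)
  then show ?thesis
    using gf3_cases[of i] by (auto simp: sum_2 line_point_def pair_coord_def)
qed

text \<open>The map is fixed by F on the eight basis tensors, whose labels are all 1 or -1.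
  Interpolating along lines, one factor at a time, gives the remaining points.\<close>

lemma trilinear_extension:
  fixes F :: "gf3 \<Rightarrow> gf3 \<Rightarrow> gf3 \<Rightarrow> V8"
  assumes "\<And>j k. F 0 j k + F 1 j k + F (- 1) j k = 0"
    and "\<And>i k. F i 0 k + F i 1 k + F i (- 1) k = 0"
    and "\<And>i j. F i j 0 + F i j 1 + F i j (- 1) = 0"
  shows "\<exists>f. Vector_Spaces.linear (*s) (*s) f \<and> (\<forall>i j k. f (segre_point i j k) = F i j k)"
proof -
  define x :: "2 \<Rightarrow> gf3" where "x r = (if r = 1 then 1 else - 1)" for r
  define f where "f w = (\<Sum>r\<in>UNIV. \<Sum>s\<in>UNIV. \<Sum>t\<in>UNIV. w $ (r, s, t) *s F (x r) (x s) (x t))"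
    for w :: "bit ^ (2 \<times> 2 \<times> 2)"
  have "Vector_Spaces.linear (*s) (*s) f"
  proof unfold_locales
    show "f (v + w) = f v + f w" for v w
      by (simp only: f_def vector_add_component vec.scale_left_distrib sum.distrib)
    show "f (c *s w) = c *s f w" for c w
      by (simp only: f_def vector_smult_component vec.scale_scale vec.scale_sum_right)
  qed
  moreover have "f (segre_point i j k) = F i j k" for i j k
  proof -
    have "f (segre_point i j k) = (\<Sum>r\<in>UNIV. line_point i $ r *s (\<Sum>s\<in>UNIV. line_point j $ s *s
        (\<Sum>t\<in>UNIV. line_point k $ t *s F (x r) (x s) (x t))))"
      by (simp add: f_def segre_point_def pure_tensor_def vec.scale_sum_right mult.assoc)
    also have "\<dots> = F i j k"
      unfolding x_def
      by (simp only: line_interpolation[where G = "\<lambda>r. F _ _ r"] line_interpolation[where G = "\<lambda>r. F _ r _"]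
          line_interpolation[where G = "\<lambda>r. F r _ _"] assms)
    finally show ?thesis .
  qed
  ultimately show ?thesis by blast
qed

lemma hyperplane_is_segre:
  assumes n: "\<And>m. n $ m \<noteq> 0"
  shows "is_segre_variety (enc ` hyperplane n c)"
proof -
  \<comment> \<open>The sign pairs (p_m, q_m) run through all four possibilities, so they separate
    the four indices.\<close>
  define p q :: "gf3 ^ 4" where "p = (\<chi> m. if m = 1 \<or> m = 2 then 1 else - 1)"
    and "q = (\<chi> m. if m = 1 \<or> m = 3 then 1 else - 1)"
  \<comment> \<open>Chosen so that the entrywise product abg is n, while ab = p and ag = q recover
    the signs whatever common factor s is applied.\<close>
  define a b g where "a = (\<chi> m. n $ m * p $ m * q $ m)" and "b = (\<chi> m. n $ m * q $ m)"
    and "g = (\<chi> m. n $ m * p $ m)"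
  define d where "d = (axis 1 (n $ 1 * c) :: gf3 ^ 4)"
  have pq: "p $ m \<noteq> 0" "q $ m \<noteq> 0" for m
    by (simp_all add: p_def q_def)
  note sq = gf3_mult_cancel
  have nz: "a $ m \<noteq> 0" "b $ m \<noteq> 0" "g $ m \<noteq> 0" for m
    by (simp_all add: a_def b_def g_def n pq)
  have "(\<Sum>m\<in>UNIV. n $ m * d $ m) = c"
    by (simp add: d_def sq n)
  moreover have "{d + i *s a + j *s b + k *s g | i j k. True} = hyperplane n (\<Sum>m\<in>UNIV. n $ m * d $ m)"
  proof (rule affine_image_eq_hyperplane)
    fix m m' s
    assume m: "m \<noteq> m'" and s: "s \<noteq> 0" "a $ m' = s * a $ m" "b $ m' = s * b $ m" "g $ m' = s * g $ m"
    have "p $ l = a $ l * b $ l" "q $ l = a $ l * g $ l" for l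
      by (simp_all add: a_def b_def g_def n pq sq ac_simps)
    then have "p $ m' = p $ m" "q $ m' = q $ m"
      by (simp_all add: s(2-4) sq s(1) ac_simps)
    with m show False
      using exhaust_4[of m] exhaust_4[of m'] by (auto simp: p_def q_def)
  qed (use nz in \<open>auto simp: vec_eq_iff a_def b_def g_def n pq sq ac_simps\<close>)
  ultimately have H: "hyperplane n c = {d + i *s a + j *s b + k *s g | i j k. True}"
    by simp
  define F where "F i j k = enc (d + i *s a + j *s b + k *s g)" for i j k
  have "\<exists>f. Vector_Spaces.linear (*s) (*s) f \<and> (\<forall>i j k. f (segre_point i j k) = F i j k)"
  proof (rule trilinear_extension)
    show "F 0 j k + F 1 j k + F (- 1) j k = 0" for j k
      using enc_sum[of a "d + j *s b + k *s g"] nz by (simp add: F_def algebra_simps)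
    show "F i 0 k + F i 1 k + F i (- 1) k = 0" for i k
      using enc_sum[of b "d + i *s a + k *s g"] nz by (simp add: F_def algebra_simps)
    show "F i j 0 + F i j 1 + F i j (- 1) = 0" for i j
      using enc_sum[of g "d + i *s a + j *s b"] nz by (simp add: F_def algebra_simps)
  qed
  then obtain f where f: "Vector_Spaces.linear (*s) (*s) f" "\<And>i j k. f (segre_point i j k) = F i j k"
    by blast
  interpret f: Vector_Spaces.linear "(*s)" "(*s)" f by (rule f(1))
  have im: "f ` {segre_point i j k | i j k. True} = enc ` hyperplane n c"
  proof -
    have "f ` {segre_point i j k | i j k. True} = {F i j k | i j k. True}"
      by (auto simp: image_def simp flip: f(2))
    also have "\<dots> = enc ` hyperplane n c"
      unfolding H F_def by blast
    finally show ?thesis .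
  qed
  have "surj f"
    using f.span_image[of "{segre_point i j k | i j k. True}"]
    unfolding im hyperplane_span[OF n] segre_points_span by simp
  \<comment> \<open>Both spaces have 2^8 elements, so surjectivity suffices.\<close>
  moreover have "inj f"
  proof (rule eq_card_imp_inj_on)
    have "card (range f) = CARD(bit) ^ CARD(8)"
      using \<open>surj f\<close> by simp
    then show "card (range f) = CARD(bit ^ (2 \<times> 2 \<times> 2))"
      by simp
  qed simp
  ultimately show ?thesis
    unfolding is_segre_variety_def nonzero_pure_tensors_eq using f(1) im
    by (intro exI[of _ f]) (simp only: bij_def simp_thms)
qed

section \<open>Cosets and the count\<close>

lemma segre_in_omega4_iff:
  "S \<subseteq> omega4 \<and> is_segre_variety S \<longleftrightarrow> (\<exists>n c. (\<forall>m. n $ m \<noteq> 0) \<and> S = enc ` hyperplane n c)"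
  using segre_in_omega4_imp_hyperplane hyperplane_is_segre by (auto simp: omega4_eq)

text \<open>One vector v extends a basis of V to a basis of the whole space. The functional that is
  1 at v and 0 on the basis of V has kernel V, and its values on the standard basis are the entries
  of n.\<close>

lemma subspace_dim3_eq_hyperplane:
  fixes V :: "(gf3 ^ 4) set"
  assumes V: "vec.subspace V" "vec.dim V = 3"
  shows "\<exists>n. V = hyperplane n 0"
proof -
  obtain B where B: "B \<subseteq> V" "vec.independent B" "V \<subseteq> vec.span B" "card B = 3"
    using vec.basis_exists[of V] V(2) by metis
  have span: "vec.span B = V"
    using B V(1) by (simp add: vec.span_minimal subset_antisym)
  have "V \<noteq> UNIV"
    using V(2) by (auto simp: vec_dim_card simp del: vec.dim_UNIV)
  then obtain v where v: "v \<notin> vec.span B"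
    using span by blast
  then have ind: "vec.independent (insert v B)"
    using B(2) vec.independent_insertI by blast
  interpret vs: vector_space_pair "(*s) :: gf3 \<Rightarrow> gf3 ^ 4 \<Rightarrow> gf3 ^ 4" "(*) :: gf3 \<Rightarrow> gf3 \<Rightarrow> gf3"
    by unfold_locales (simp_all add: algebra_simps)
  obtain g where g: "Vector_Spaces.linear (*s) (*) g" and gB: "\<forall>x\<in>insert v B. g x = (if x = v then 1 else 0)"
    using vs.linear_independent_extend[OF ind, of "\<lambda>x. if x = v then 1 else 0"] by blast
  interpret g: Vector_Spaces.linear "(*s)" "(*)" g by (rule g)
  have g0: "g x = 0" if "x \<in> V" for x
    using that unfolding span[symmetric]
  proof (induction rule: vec.span_induct_alt)
    case (step c x y)
    then have "x \<noteq> v" using v vec.span_base by blast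
    with step gB show ?case by (simp add: g.add g.scale)
  qed (simp add: g.zero)
  have "V = {x. g x = 0}"
  proof (intro equalityI subsetI)
    fix x
    assume "x \<in> {x. g x = 0}"
    then have gx: "g x = 0" by simp
    have "card (insert v B) = 4"
      using B(4) v vec.span_base[of v B] by (subst card_insert_disjoint) (auto intro: card_ge_0_finite)
    then have "UNIV \<subseteq> vec.span (insert v B)"
      by (intro vec.card_ge_dim_independent ind) (simp_all add: vec_dim_card del: vec.dim_UNIV)
    then obtain r where r: "x - r *s v \<in> vec.span B"
      using vec.span_breakdown_eq by blast
    then have "g (x - r *s v) = 0"
      using g0 span by simp
    then have "r = 0"
      using gx gB by (simp add: g.diff g.scale)
    with r span show "x \<in> V" by simp
  qed (simp add: g0)
  moreover have g_sum: "g x = (\<Sum>m\<in>UNIV. (\<chi> m. g (axis m 1)) $ m * x $ m)" for x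
    by (subst basis_expansion[symmetric, of x]) (simp add: g.sum g.scale mult.commute)
  ultimately have "V = hyperplane (\<chi> m. g (axis m 1)) 0"
    unfolding hyperplane_def g_sum[symmetric] by blast
  then show ?thesis ..
qed

lemma axis_in_hyperplane_iff [simp]: "axis i x \<in> hyperplane n c \<longleftrightarrow> n $ i * x = c"
  by (simp add: hyperplane_def)

lemma kind_P0_hyperplane:
  assumes "vec.subspace (hyperplane n 0)"
  shows "kind_P0 (proj_points (hyperplane n 0)) \<longleftrightarrow> (\<forall>m. n $ m \<noteq> 0)"
proof -
  have "vec.span {axis m 1} \<in> proj_points (hyperplane n 0) \<longleftrightarrow> axis m 1 \<in> hyperplane n 0" for m
  proof -
    have "vec.dim (vec.span {axis m (1 :: gf3) :: gf3 ^ 4}) = 1"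
      using vec.dim_eq_card_independent[of "{axis m (1 :: gf3) :: gf3 ^ 4}"]
      by (simp add: vec.dim_span axis_eq_0_iff)
    then show ?thesis
      using vec.span_minimal[OF _ assms, of "{axis m 1}"] vec.span_base[of _ "{axis m 1}"]
      unfolding proj_points_def by auto
  qed
  then show ?thesis
    by (simp add: kind_P0_def)
qed

text \<open>Translating labels by k carries the hyperplane through 0 to the parallel one through
  k.\<close>

lemma image_R_set_rcosets:
  "R_set ` (rcosets\<^bsub>G81\<^esub> (A_map ` hyperplane n 0)) = {enc ` hyperplane n (\<Sum>m\<in>UNIV. n $ m * k $ m) | k. True}"
proof -
  have "R_set (A_map ` hyperplane n 0 #>\<^bsub>G81\<^esub> A_map k) = enc ` hyperplane n (\<Sum>m\<in>UNIV. n $ m * k $ m)" for k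
  proof -
    have "R_set (A_map ` hyperplane n 0 #>\<^bsub>G81\<^esub> A_map k) = {enc (l + k) | l. l \<in> hyperplane n 0}"
      unfolding R_set_def r_coset_def G81_def u_vec_eq
      by (auto simp: A_map_enc) (metis A_map_enc add_0_right comp_apply)
    also have "\<dots> = enc ` hyperplane n (\<Sum>m\<in>UNIV. n $ m * k $ m)"
    proof (intro equalityI subsetI)
      fix v
      assume "v \<in> enc ` hyperplane n (\<Sum>m\<in>UNIV. n $ m * k $ m)"
      then obtain l where l: "v = enc l" "l \<in> hyperplane n (\<Sum>m\<in>UNIV. n $ m * k $ m)" by blast
      then have "l - k \<in> hyperplane n 0"
        by (simp add: hyperplane_def right_diff_distrib sum_subtractf)
      moreover have "v = enc (l - k + k)" using l by simp
      ultimately show "v \<in> {enc (l + k) | l. l \<in> hyperplane n 0}" by blast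
    qed (auto simp: hyperplane_def distrib_left sum.distrib)
    finally show ?thesis .
  qed
  then show ?thesis
    by (auto simp: RCOSETS_def G81_def image_iff)
qed

lemma cosets_segre_iff:
  "(\<forall>K\<in>rcosets\<^bsub>G81\<^esub> (A_map ` hyperplane n 0). is_segre_variety (R_set K)) \<longleftrightarrow> (\<forall>m. n $ m \<noteq> 0)"
proof -
  have "(\<forall>K\<in>rcosets\<^bsub>G81\<^esub> (A_map ` hyperplane n 0). is_segre_variety (R_set K)) \<longleftrightarrow>
      (\<forall>S\<in>R_set ` (rcosets\<^bsub>G81\<^esub> (A_map ` hyperplane n 0)). is_segre_variety S)"
    by simp
  also have "\<dots> \<longleftrightarrow> (\<forall>k. is_segre_variety (enc ` hyperplane n (\<Sum>m\<in>UNIV. n $ m * k $ m)))"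
    unfolding image_R_set_rcosets by blast
  also have "\<dots> \<longleftrightarrow> (\<forall>m. n $ m \<noteq> 0)"
  proof
    assume "\<forall>k. is_segre_variety (enc ` hyperplane n (\<Sum>m\<in>UNIV. n $ m * k $ m))"
    \<comment> \<open>The subgroup itself, as the coset with k = 0, already determines the
      answer.\<close>
    then have "is_segre_variety (enc ` hyperplane n (\<Sum>m\<in>UNIV. n $ m * (0 :: gf3 ^ 4) $ m))" ..
    then have "is_segre_variety (enc ` hyperplane n 0)" by simp
    moreover have "enc ` hyperplane n 0 \<subseteq> omega4" by (auto simp: omega4_eq)
    ultimately obtain n' c' where n': "\<forall>m. n' $ m \<noteq> 0" and "enc ` hyperplane n 0 = enc ` hyperplane n' c'"
      using segre_in_omega4_imp_hyperplane by blast
    then have eq: "hyperplane n 0 = hyperplane n' c'"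
      by (simp add: inj_image_eq_iff inj_enc)
    \<comment> \<open>Multiples of the standard basis vectors detect both the constant (x = 0) and
      the zero entries of the normal vector (x = 1).\<close>
    have iff: "n $ i * x = 0 \<longleftrightarrow> n' $ i * x = c'" for i x
      using eq axis_in_hyperplane_iff[of i x n 0] axis_in_hyperplane_iff[of i x n' c'] by simp
    have "c' = 0" using iff[of 1 0] by simp
    then show "\<forall>m. n $ m \<noteq> 0"
      using iff[of _ 1] n' by simp
  qed (simp add: hyperplane_is_segre)
  finally show ?thesis .
qed

lemma card_segre_in_omega4: "card {S. S \<subseteq> omega4 \<and> is_segre_variety S} = 24"
proof -
  \<comment> \<open>Normal vectors scaled to have fourth entry 1: three free signs and three
    constants give 8 * 3 pairs.\<close>
  define w :: "gf3 \<Rightarrow> gf3 \<Rightarrow> gf3 \<Rightarrow> gf3 ^ 4" where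
    "w x y z = (\<chi> m. if m = 1 then x else if m = 2 then y else if m = 3 then z else 1)" for x y z
  define h where "h = (\<lambda>(x, y, z, c). enc ` hyperplane (w x y z) c)"
  let ?U = "{1, - 1 :: gf3} \<times> {1, - 1 :: gf3} \<times> {1, - 1 :: gf3} \<times> (UNIV :: gf3 set)"
  have "{S. S \<subseteq> omega4 \<and> is_segre_variety S} = h ` ?U"
  proof (intro equalityI subsetI)
    fix S
    assume "S \<in> {S. S \<subseteq> omega4 \<and> is_segre_variety S}"
    then obtain n c where n: "\<forall>m. n $ m \<noteq> 0" and S: "S = enc ` hyperplane n c"
      by (auto simp: segre_in_omega4_iff)
    let ?x = "n $ 4 * n $ 1" and ?y = "n $ 4 * n $ 2" and ?z = "n $ 4 * n $ 3"
    have "w ?x ?y ?z = n $ 4 *s n"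
      using n by (simp add: vec_eq_iff forall_4 w_def)
    then have "(\<Sum>m\<in>UNIV. w ?x ?y ?z $ m * l $ m) = n $ 4 * (\<Sum>m\<in>UNIV. n $ m * l $ m)" for l
      by (simp add: sum_distrib_left mult.assoc)
    then have "hyperplane n c = hyperplane (w ?x ?y ?z) (n $ 4 * c)"
      using n by (simp add: hyperplane_def)
    moreover have "(?x, ?y, ?z, n $ 4 * c) \<in> ?U"
      using n by (simp flip: gf3_nz_cases)
    ultimately show "S \<in> h ` ?U"
      by (intro image_eqI[of _ _ "(?x, ?y, ?z, n $ 4 * c)"]) (simp_all only: h_def S prod.case)
  next
    fix S
    assume "S \<in> h ` ?U"
    then obtain x y z c where S: "S = enc ` hyperplane (w x y z) c" and "x \<noteq> 0" "y \<noteq> 0" "z \<noteq> 0"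
      by (auto simp: h_def gf3_nz_cases)
    then have "\<forall>m. w x y z $ m \<noteq> 0"
      by (simp add: w_def)
    with S show "S \<in> {S. S \<subseteq> omega4 \<and> is_segre_variety S}"
      unfolding mem_Collect_eq segre_in_omega4_iff by blast
  qed
  moreover have "inj_on h ?U"
  proof -
    have "x = x' \<and> y = y' \<and> z = z' \<and> c = c'"
      if "hyperplane (w x y z) c = hyperplane (w x' y' z') c'" for x y z c x' y' z' c'
    proof -
      \<comment> \<open>As the fourth entry of the normal vector is 1, the point
        \<open>axis 4 c\<close> lies on the first hyperplane and reveals the constant of the
        second.\<close>
      have c: "c = c'"
        using that axis_in_hyperplane_iff[of 4 c "w x y z" c] axis_in_hyperplane_iff[of 4 c "w x' y' z'" c']
        by (simp add: w_def)
      have "w x y z $ i = w x' y' z' $ i" if "i \<noteq> 4" for i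
      proof -
        \<comment> \<open>A point of the first hyperplane whose fourth coordinate compensates the
          i-th entry of the normal vector; on the second hyperplane it forces the same
          entry.\<close>
        let ?l = "axis i 1 + axis 4 (c - w x y z $ i)"
        have "?l \<in> hyperplane (w x y z) c"
          by (simp add: hyperplane_def distrib_left sum.distrib) (simp add: w_def)
        then have "?l \<in> hyperplane (w x' y' z') c'"
          using \<open>hyperplane (w x y z) c = _\<close> by simp
        then have "w x' y' z' $ i + (c - w x y z $ i) = c'"
          by (simp add: hyperplane_def distrib_left sum.distrib) (simp add: w_def)
        then show ?thesis using c by simp
      qed
      from this[of 1] this[of 2] this[of 3] c show ?thesis
        by (simp add: w_def)
    qed
    then have "p = p'" if "h p = h p'" for p p'
      using that by (cases p; cases p') (simp add: h_def inj_image_eq_iff inj_enc)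
    then show ?thesis
      by (rule inj_onI)
  qed
  ultimately have "card {S. S \<subseteq> omega4 \<and> is_segre_variety S} = card ?U"
    by (simp only: card_image)
  also have "\<dots> = 24"
    by (simp only: UNIV_gf3 card_cartesian_product) simp
  finally show ?thesis .
qed

theorem theorem6:
  shows "(\<forall>V3 H. vec.subspace V3 \<and> vec.dim V3 = 3 \<and> H = A_map ` V3 \<longrightarrow>
            ((\<forall>K \<in> rcosets\<^bsub>G81\<^esub> H. is_segre_variety (R_set K)) \<longleftrightarrow> kind_P0 (proj_points V3)))
       \<and> card {S. S \<subseteq> omega4 \<and> is_segre_variety S} = 24"
proof (intro conjI allI impI)
  fix V3 H
  assume *: "vec.subspace V3 \<and> vec.dim V3 = 3 \<and> H = A_map ` V3"
  then obtain n where "V3 = hyperplane n 0"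
    using subspace_dim3_eq_hyperplane by blast
  with * show "(\<forall>K \<in> rcosets\<^bsub>G81\<^esub> H. is_segre_variety (R_set K)) \<longleftrightarrow> kind_P0 (proj_points V3)"
    by (simp add: cosets_segre_iff kind_P0_hyperplane)
qed (rule card_segre_in_omega4)

end
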